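(* Let $X$ be a topological space that is a Baire space. Then $(\mathcal{L}(X),\tau_w)$ and $(\mathcal{L}'(X),\tau_w)$ are Baire spaces.
   Context: No separation axioms are assumed on topological spaces. A Baire space is a topological space in which the intersection of any sequence of dense open subsets is dense. For a topological space $X$, $\mathcal{F}(X)$ is the set of all closed subsets of $X$ (including $\emptyset$). A subset $L\subset X$ is a limit set if there is a net in $X$ that converges to every point of $L$; equivalently, every finite family of open subsets of $X$ each of which intersects $L$ has nonempty intersection. $\mathcal{L}(X)$ is the set of all closed limit sets of $X$, and $\mathcal{L}'(X)$ is the set of all nonempty closed limit sets. The topology $\tau_w$ (lower semifinite topology) on $\mathcal{F}(X)$ is the one having as a base the sets $\mathcal{U}(\emptyset,\Phi)=\{A\in\mathcal{F}(X)\mid A\cap O\neq\emptyset \text{ for all } O\in\Phi\}$, where $\Phi$ runs through all finite (possibly empty) families of open subsets of $X$. $\mathcal{L}(X)$ and $\mathcal{L}'(X)$ carry the subspace topologies, still denoted $\tau_w$. *)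

theory Defs
  imports "HOL-Analysis.Analysis"
begin

definition Baire_space :: "'a topology \<Rightarrow> bool" where
  "Baire_space X \<longleftrightarrow>
     (\<forall>G :: nat \<Rightarrow> 'a set.
        (\<forall>n. openin X (G n) \<and> X closure_of (G n) = topspace X) \<longrightarrow>
        X closure_of (\<Inter>n. G n) = topspace X)"

definition directed_set :: "'i set \<Rightarrow> 'i rel \<Rightarrow> bool" where
  "directed_set D r \<longleftrightarrow>
     D \<noteq> {} \<and> preorder_on D r \<and> (\<forall>i\<in>D. \<forall>j\<in>D. \<exists>k\<in>D. (i, k) \<in> r \<and> (j, k) \<in> r)"

definition tails :: "'i set \<Rightarrow> 'i rel \<Rightarrow> 'i filter" where
  "tails D r = (INF i\<in>D. principal (r `` {i}))"

text \<open>HOL cannot quantify over the index type of a net inside a definition, so the index sets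
  are taken to be sets of subsets of the space. This is no restriction: by
  \<open>limit_set_if_net\<close> below, nets over any index type yield the same limit sets.\<close>

definition limit_set :: "'a topology \<Rightarrow> 'a set \<Rightarrow> bool" where
  "limit_set X L \<longleftrightarrow>
     L \<subseteq> topspace X \<and>
     (\<exists>(D :: 'a set set) r x. directed_set D r \<and> x ` D \<subseteq> topspace X \<and>
        (\<forall>l\<in>L. limitin X x l (tails D r)))"

definition closed_limit_sets :: "'a topology \<Rightarrow> 'a set set" where
  "closed_limit_sets X = {A. closedin X A \<and> limit_set X A}"

definition nonempty_closed_limit_sets :: "'a topology \<Rightarrow> 'a set set" where
  "nonempty_closed_limit_sets X = {A \<in> closed_limit_sets X. A \<noteq> {}}"

definition hit_sets :: "'a topology \<Rightarrow> 'a set set \<Rightarrow> 'a set set" where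
  "hit_sets X \<Phi> = {A. closedin X A \<and> (\<forall>U\<in>\<Phi>. A \<inter> U \<noteq> {})}"

text \<open>The empty family is allowed, so the whole hyperspace is a basic open set.\<close>

definition lower_base :: "'a topology \<Rightarrow> 'a set set \<Rightarrow> bool" where
  "lower_base X \<U> \<longleftrightarrow> (\<exists>\<Phi>. finite \<Phi> \<and> (\<forall>U\<in>\<Phi>. openin X U) \<and> \<U> = hit_sets X \<Phi>)"

definition lower_topology :: "'a topology \<Rightarrow> 'a set topology" where
  "lower_topology X = topology (arbitrary union_of (lower_base X))"

lemma openin_lower_topology:
  "openin (lower_topology X) = arbitrary union_of (lower_base X)"
proof -
  have "lower_base X (S \<inter> T)" if "lower_base X S" "lower_base X T" for S T
  proof -
    from that obtain \<Phi> \<Psi> where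
      "finite \<Phi>" "\<forall>U\<in>\<Phi>. openin X U" "S = hit_sets X \<Phi>"
      "finite \<Psi>" "\<forall>U\<in>\<Psi>. openin X U" "T = hit_sets X \<Psi>"
      unfolding lower_base_def by blast
    then have "finite (\<Phi> \<union> \<Psi>)" "\<forall>U\<in>\<Phi> \<union> \<Psi>. openin X U" "S \<inter> T = hit_sets X (\<Phi> \<union> \<Psi>)"
      by (auto simp: hit_sets_def)
    then show ?thesis
      unfolding lower_base_def by blast
  qed
  then have "istopology (arbitrary union_of (lower_base X))"
    by (rule istopology_base)
  then show ?thesis
    unfolding lower_topology_def by (rule topology_inverse')
qed

lemma topspace_lower_topology: "topspace (lower_topology X) = {A. closedin X A}"
proof
  show "topspace (lower_topology X) \<subseteq> {A. closedin X A}"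
    by (auto simp: topspace_def openin_lower_topology union_of_def lower_base_def hit_sets_def)
  have "lower_base X (hit_sets X {})"
    unfolding lower_base_def by blast
  then have "openin (lower_topology X) (hit_sets X {})"
    unfolding openin_lower_topology by (rule arbitrary_union_of_inc)
  then show "{A. closedin X A} \<subseteq> topspace (lower_topology X)"
    by (auto simp: hit_sets_def dest: openin_subset)
qed

lemma eventually_tails:
  assumes "directed_set D r"
  shows "eventually P (tails D r) \<longleftrightarrow> (\<exists>i\<in>D. \<forall>j. (i, j) \<in> r \<longrightarrow> P j)"
proof -
  have tr: "trans r" and ne: "D \<noteq> {}"
    using assms by (auto simp: directed_set_def preorder_on_def)
  have "eventually P (tails D r) \<longleftrightarrow> (\<exists>i\<in>D. eventually P (principal (r `` {i})))"
    unfolding tails_def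
  proof (rule eventually_INF_base[OF ne])
    fix i j assume "i \<in> D" "j \<in> D"
    then obtain k where "k \<in> D" "(i, k) \<in> r" "(j, k) \<in> r"
      using assms by (auto simp: directed_set_def)
    then show "\<exists>x\<in>D. principal (r `` {x}) \<le> inf (principal (r `` {i})) (principal (r `` {j}))"
      using tr by (intro bexI[of _ k]) (auto dest: transD)
  qed
  then show ?thesis
    by (auto simp: eventually_principal)
qed

lemma net_meets_finite_families:
  assumes D: "directed_set D r" and x: "x ` D \<subseteq> topspace X"
    and lim: "\<And>l. l \<in> L \<Longrightarrow> limitin X x l (tails D r)"
    and \<Phi>: "finite \<Phi>" "\<And>U. U \<in> \<Phi> \<Longrightarrow> openin X U \<and> U \<inter> L \<noteq> {}"
  shows "topspace X \<inter> \<Inter>\<Phi> \<noteq> {}"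
proof -
  have "\<forall>U\<in>\<Phi>. eventually (\<lambda>j. x j \<in> U) (tails D r)"
    using \<Phi>(2) lim by (fastforce simp: limitin_def)
  then have "eventually (\<lambda>j. \<forall>U\<in>\<Phi>. x j \<in> U) (tails D r)"
    using \<Phi>(1) by (simp add: eventually_ball_finite)
  then obtain i where "i \<in> D" "\<forall>j. (i, j) \<in> r \<longrightarrow> (\<forall>U\<in>\<Phi>. x j \<in> U)"
    unfolding eventually_tails[OF D] by (elim bexE)
  moreover have "(i, i) \<in> r"
    using D \<open>i \<in> D\<close> by (auto simp: directed_set_def preorder_on_def refl_on_def)
  ultimately have "x i \<in> topspace X \<inter> \<Inter>\<Phi>"
    using x by auto
  then show ?thesis
    by blast
qed

lemma limit_set_iff_finite_families:
  "limit_set X L \<longleftrightarrow>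
     L \<subseteq> topspace X \<and>
     (\<forall>\<Phi>. finite \<Phi> \<and> (\<forall>U\<in>\<Phi>. openin X U \<and> U \<inter> L \<noteq> {}) \<longrightarrow> topspace X \<inter> \<Inter>\<Phi> \<noteq> {})"
  (is "_ \<longleftrightarrow> ?R")
proof
  assume "limit_set X L"
  then obtain D :: "'a set set" and r x where
    L: "L \<subseteq> topspace X" and net: "directed_set D r" "x ` D \<subseteq> topspace X"
      "\<And>l. l \<in> L \<Longrightarrow> limitin X x l (tails D r)"
    unfolding limit_set_def by auto
  show ?R
  proof (intro conjI allI impI)
    fix \<Phi> assume "finite \<Phi> \<and> (\<forall>U\<in>\<Phi>. openin X U \<and> U \<inter> L \<noteq> {})"
    then show "topspace X \<inter> \<Inter>\<Phi> \<noteq> {}"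
      by (intro net_meets_finite_families[OF net]) auto
  qed (rule L)
next
  assume R: ?R
  define ok where "ok \<Phi> \<longleftrightarrow> finite \<Phi> \<and> (\<forall>U\<in>\<Phi>. openin X U \<and> U \<inter> L \<noteq> {})" for \<Phi>
  define D where "D = (\<lambda>\<Phi>. topspace X \<inter> \<Inter>\<Phi>) ` {\<Phi>. ok \<Phi>}"
  define r where "r = {(A, B). A \<in> D \<and> B \<in> D \<and> B \<subseteq> A}"
  define x where "x A = (SOME a. a \<in> A)" for A :: "'a set"
  have ne: "x A \<in> A" if "A \<in> D" for A
  proof -
    have "A \<noteq> {}"
      using that R by (auto simp: D_def ok_def)
    then show ?thesis
      unfolding x_def by (simp add: some_in_eq)
  qed
  have Int: "A \<inter> B \<in> D" if "A \<in> D" "B \<in> D" for A B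
  proof -
    from that obtain \<Phi> \<Psi> where "ok \<Phi>" "ok \<Psi>" "A = topspace X \<inter> \<Inter>\<Phi>" "B = topspace X \<inter> \<Inter>\<Psi>"
      by (auto simp: D_def)
    then have "ok (\<Phi> \<union> \<Psi>)" "A \<inter> B = topspace X \<inter> \<Inter>(\<Phi> \<union> \<Psi>)"
      by (auto simp: ok_def)
    then show ?thesis
      unfolding D_def by blast
  qed
  have "ok {}"
    by (simp add: ok_def)
  then have "D \<noteq> {}"
    by (auto simp: D_def)
  moreover have "preorder_on D r"
    by (auto simp: preorder_on_def refl_on_def trans_def r_def)
  moreover have "\<exists>C\<in>D. (A, C) \<in> r \<and> (B, C) \<in> r" if "A \<in> D" "B \<in> D" for A B
    using that Int by (intro bexI[of _ "A \<inter> B"]) (auto simp: r_def)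
  ultimately have D: "directed_set D r"
    by (simp add: directed_set_def)
  moreover have "x ` D \<subseteq> topspace X"
  proof (rule image_subsetI)
    fix A assume "A \<in> D"
    moreover from this have "A \<subseteq> topspace X"
      by (auto simp: D_def)
    ultimately show "x A \<in> topspace X"
      using ne by blast
  qed
  moreover have "limitin X x l (tails D r)" if "l \<in> L" for l
    unfolding limitin_def
  proof (intro conjI allI impI)
    show "l \<in> topspace X"
      using that R by auto
    fix U assume U: "openin X U \<and> l \<in> U"
    have "ok {U}"
      using U that by (auto simp: ok_def)
    then have "topspace X \<inter> \<Inter>{U} \<in> D"
      unfolding D_def by blast
    moreover have "topspace X \<inter> \<Inter>{U} = U"
      using U openin_subset by auto
    ultimately have "U \<in> D"
      by simp
    then show "\<forall>\<^sub>F A in tails D r. x A \<in> U"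
      unfolding eventually_tails[OF D] using ne by (auto simp: r_def)
  qed
  ultimately show "limit_set X L"
    using R unfolding limit_set_def by (intro conjI exI[of _ D] exI[of _ r] exI[of _ x]) simp_all
qed

lemma limit_set_if_net:
  fixes D :: "'i set" and X :: "'a topology"
  assumes "L \<subseteq> topspace X" "directed_set D r" "x ` D \<subseteq> topspace X"
    and "\<And>l. l \<in> L \<Longrightarrow> limitin X x l (tails D r)"
  shows "limit_set X L"
  unfolding limit_set_iff_finite_families
proof (intro conjI allI impI)
  fix \<Phi> assume "finite \<Phi> \<and> (\<forall>U\<in>\<Phi>. openin X U \<and> U \<inter> L \<noteq> {})"
  then show "topspace X \<inter> \<Inter>\<Phi> \<noteq> {}"
    by (intro net_meets_finite_families[OF assms(2-4)]) auto
qed (rule assms(1))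

end

theory Submission
  imports Defs
begin

text \<open>The map \<open>e\<close> sending \<open>x\<close> to the closure of \<open>{x}\<close> takes values in the nonempty closed
  limit sets, and the preimage of the basic open set given by \<open>\<Phi>\<close> is \<open>\<Inter>\<Phi>\<close>. By the
  finite-family characterization of limit sets, that intersection is nonempty as soon as some
  limit set meets every member of \<open>\<Phi>\<close>, so \<open>e\<close> has dense range, also in the space that contains
  the empty set. Hence dense open sets pull back along \<open>e\<close> to dense open sets, and density of
  the intersection is pushed forward again.\<close>

text \<open>Continuity makes the preimages \<open>H n\<close> open but not dense. Density comes from
  \<open>inner\<close>, which shrinks an open set of \<open>X\<close> to the preimage of a nonempty
  open \<open>W\<close>, combined with \<open>dense\<close> applied to the nonempty open set
  \<open>G n \<inter> W\<close>.\<close>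

lemma Baire_space_transfer:
  assumes "Baire_space X" and f: "continuous_map X Y f"
    and dense: "\<And>W. openin Y W \<Longrightarrow> W \<noteq> {} \<Longrightarrow> \<exists>x\<in>topspace X. f x \<in> W"
    and inner: "\<And>V. openin X V \<Longrightarrow> V \<noteq> {} \<Longrightarrow>
      \<exists>W. openin Y W \<and> W \<noteq> {} \<and> {x \<in> topspace X. f x \<in> W} \<subseteq> V"
  shows "Baire_space Y"
  unfolding Baire_space_def
proof (intro allI impI)
  fix G :: "nat \<Rightarrow> 'b set"
  assume G: "\<forall>n. openin Y (G n) \<and> Y closure_of (G n) = topspace Y"
  define H where "H n = {x \<in> topspace X. f x \<in> G n}" for n
  have "openin X (H n)" for n
    unfolding H_def using f G by (intro openin_continuous_map_preimage) auto
  moreover have "X closure_of (H n) = topspace X" for n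
    unfolding dense_intersects_open
  proof (intro allI impI)
    fix V assume "openin X V \<and> V \<noteq> {}"
    then obtain W where W: "openin Y W" "W \<noteq> {}" "{x \<in> topspace X. f x \<in> W} \<subseteq> V"
      using inner by blast
    have "G n \<inter> W \<noteq> {}"
      using G W(1,2) by (simp add: dense_intersects_open)
    moreover have "openin Y (G n \<inter> W)"
      using G W(1) by (simp add: openin_Int)
    ultimately obtain x where "x \<in> topspace X" "f x \<in> G n \<inter> W"
      using dense by blast
    then show "H n \<inter> V \<noteq> {}"
      using W(3) by (auto simp: H_def)
  qed
  ultimately have H: "X closure_of (\<Inter>n. H n) = topspace X"
    using \<open>Baire_space X\<close> unfolding Baire_space_def by blast
  show "Y closure_of (\<Inter>n. G n) = topspace Y"
    unfolding dense_intersects_open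
  proof (intro allI impI)
    fix W assume W: "openin Y W \<and> W \<noteq> {}"
    have "openin X {x \<in> topspace X. f x \<in> W}"
      using f W by (intro openin_continuous_map_preimage) auto
    moreover have "{x \<in> topspace X. f x \<in> W} \<noteq> {}"
      using dense W by blast
    ultimately have "(\<Inter>n. H n) \<inter> {x \<in> topspace X. f x \<in> W} \<noteq> {}"
      using H unfolding dense_intersects_open by simp
    then show "(\<Inter>n. G n) \<inter> W \<noteq> {}"
      by (auto simp: H_def)
  qed
qed

lemma openin_hit_sets:
  assumes "finite \<Phi>" "\<And>U. U \<in> \<Phi> \<Longrightarrow> openin X U"
  shows "openin (lower_topology X) (hit_sets X \<Phi>)"
  unfolding openin_lower_topology
  using assms by (intro arbitrary_union_of_inc) (auto simp: lower_base_def)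

lemma openin_lower_topology_cases:
  assumes "openin (lower_topology X) \<U>" "A \<in> \<U>"
  obtains \<Phi> where "finite \<Phi>" "\<And>U. U \<in> \<Phi> \<Longrightarrow> openin X U" "A \<in> hit_sets X \<Phi>" "hit_sets X \<Phi> \<subseteq> \<U>"
proof -
  obtain \<B> where "\<B> \<subseteq> Collect (lower_base X)" "\<Union>\<B> = \<U>"
    using assms(1) by (auto simp: openin_lower_topology union_of_def)
  then obtain B where "lower_base X B" "A \<in> B" "B \<subseteq> \<U>"
    using assms(2) by blast
  then obtain \<Phi> where "finite \<Phi>" "\<forall>U\<in>\<Phi>. openin X U" "B = hit_sets X \<Phi>"
    unfolding lower_base_def by blast
  with \<open>A \<in> B\<close> \<open>B \<subseteq> \<U>\<close> show thesis
    by (intro that[of \<Phi>]) simp_all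
qed

text \<open>An open set disjoint from a set is also disjoint from its closure; for a singleton,
  meeting it means containing its point.\<close>

lemma closure_of_singleton_meets_open:
  assumes "x \<in> topspace X" "openin X U"
  shows "X closure_of {x} \<inter> U \<noteq> {} \<longleftrightarrow> x \<in> U"
  using openin_Int_closure_of_eq_empty[OF assms(2), of "{x}"] by (auto simp: Int_commute)

lemma closure_of_singleton_in_hit_sets:
  assumes "x \<in> topspace X" "\<And>U. U \<in> \<Phi> \<Longrightarrow> openin X U"
  shows "X closure_of {x} \<in> hit_sets X \<Phi> \<longleftrightarrow> x \<in> \<Inter>\<Phi>"
  using assms closure_of_singleton_meets_open[OF assms(1)] by (auto simp: hit_sets_def)

text \<open>Every open set meeting the closure of \<open>{x}\<close> already contains
  \<open>x\<close>, so \<open>x\<close> itself is a common point of any family of such sets.\<close>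

lemma closure_of_singleton_limit_set:
  assumes "x \<in> topspace X"
  shows "X closure_of {x} \<in> nonempty_closed_limit_sets X"
proof -
  have "x \<in> topspace X \<inter> \<Inter>\<Phi>" if "\<forall>U\<in>\<Phi>. openin X U \<and> U \<inter> X closure_of {x} \<noteq> {}" for \<Phi>
    using assms that closure_of_singleton_meets_open[OF assms] by (auto simp: Int_commute)
  then have "limit_set X (X closure_of {x})"
    unfolding limit_set_iff_finite_families
    by (intro conjI allI impI closure_of_subset_topspace) (metis empty_iff)
  moreover have "X closure_of {x} \<noteq> {}"
    using assms by (simp add: closure_of_eq_empty_gen)
  ultimately show ?thesis
    by (simp add: nonempty_closed_limit_sets_def closed_limit_sets_def)
qed

lemma continuous_map_closure_of_singleton:
  "continuous_map X (lower_topology X) (\<lambda>x. X closure_of {x})"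
  unfolding continuous_map_def
proof (intro conjI allI impI)
  show "(\<lambda>x. X closure_of {x}) \<in> topspace X \<rightarrow> topspace (lower_topology X)"
    by (simp add: topspace_lower_topology)
next
  fix \<U> assume \<U>: "openin (lower_topology X) \<U>"
  show "openin X {x \<in> topspace X. X closure_of {x} \<in> \<U>}"
  proof (subst openin_subopen, intro ballI)
    fix x assume "x \<in> {x \<in> topspace X. X closure_of {x} \<in> \<U>}"
    then have x: "x \<in> topspace X" "X closure_of {x} \<in> \<U>"
      by auto
    from \<U> x(2) obtain \<Phi> where \<Phi>: "finite \<Phi>" "\<And>U. U \<in> \<Phi> \<Longrightarrow> openin X U"
      "X closure_of {x} \<in> hit_sets X \<Phi>" "hit_sets X \<Phi> \<subseteq> \<U>"
      by (rule openin_lower_topology_cases) blast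
    note hit = closure_of_singleton_in_hit_sets[OF _ \<Phi>(2)]
    \<comment> \<open>The intersection with \<open>topspace X\<close> covers the case of empty
      \<open>\<Phi>\<close>, where \<open>\<Inter>\<Phi>\<close> is the whole type.\<close>
    have "openin X (topspace X \<inter> \<Inter>\<Phi>)"
      using \<Phi>(1,2) by (intro openin_Int_Inter) auto
    moreover have "x \<in> topspace X \<inter> \<Inter>\<Phi>"
      using x(1) hit[OF x(1)] \<Phi>(3) by simp
    moreover have "topspace X \<inter> \<Inter>\<Phi> \<subseteq> {x \<in> topspace X. X closure_of {x} \<in> \<U>}"
    proof
      fix y assume "y \<in> topspace X \<inter> \<Inter>\<Phi>"
      then have "y \<in> topspace X" "X closure_of {y} \<in> hit_sets X \<Phi>"
        using hit[of y] by simp_all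
      then show "y \<in> {x \<in> topspace X. X closure_of {x} \<in> \<U>}"
        using \<Phi>(4) by blast
    qed
    ultimately show "\<exists>T. openin X T \<and> x \<in> T \<and> T \<subseteq> {x \<in> topspace X. X closure_of {x} \<in> \<U>}"
      by blast
  qed
qed

text \<open>Bounding \<open>S\<close> on both sides treats the spaces with and without the empty set
  at once: the lower bound puts all closures of points into \<open>S\<close>, the upper bound makes
  every member of \<open>S\<close> a limit set.\<close>

lemma Baire_space_limit_sets:
  assumes "Baire_space X"
    and S: "nonempty_closed_limit_sets X \<subseteq> S" "S \<subseteq> closed_limit_sets X"
  shows "Baire_space (subtopology (lower_topology X) S)"
proof (rule Baire_space_transfer[OF \<open>Baire_space X\<close>])
  have in_S: "X closure_of {x} \<in> S" if "x \<in> topspace X" for x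
    by (rule subsetD[OF S(1) closure_of_singleton_limit_set[OF that]])
  then show "continuous_map X (subtopology (lower_topology X) S) (\<lambda>x. X closure_of {x})"
    by (intro continuous_map_into_subtopology continuous_map_closure_of_singleton) auto
  show "\<exists>x\<in>topspace X. X closure_of {x} \<in> W"
    if "openin (subtopology (lower_topology X) S) W" "W \<noteq> {}" for W
  proof -
    from that obtain \<U> A where \<U>: "openin (lower_topology X) \<U>" "W = \<U> \<inter> S" and A: "A \<in> \<U>" "A \<in> S"
      by (auto simp: openin_subtopology)
    from \<U>(1) A(1) obtain \<Phi> where \<Phi>: "finite \<Phi>" "\<And>U. U \<in> \<Phi> \<Longrightarrow> openin X U"
      "A \<in> hit_sets X \<Phi>" "hit_sets X \<Phi> \<subseteq> \<U>"
      by (rule openin_lower_topology_cases) blast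
    have "limit_set X A"
      using A(2) S(2) by (auto simp: closed_limit_sets_def)
    moreover have "\<forall>U\<in>\<Phi>. openin X U \<and> U \<inter> A \<noteq> {}"
      using \<Phi>(2,3) by (auto simp: hit_sets_def Int_commute)
    \<comment> \<open>This includes \<open>A = {}\<close>: then \<open>\<Phi>\<close> is empty and
      the claim is that \<open>X\<close> has a point, which holds because a limit set comes with a
      net in \<open>X\<close>.\<close>
    ultimately have "topspace X \<inter> \<Inter>\<Phi> \<noteq> {}"
      using \<Phi>(1) by (simp add: limit_set_iff_finite_families)
    then obtain x where x: "x \<in> topspace X" "x \<in> \<Inter>\<Phi>"
      by blast
    then have "X closure_of {x} \<in> hit_sets X \<Phi>"
      using closure_of_singleton_in_hit_sets[OF x(1) \<Phi>(2)] by simp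
    then have "X closure_of {x} \<in> \<U>"
      using \<Phi>(4) by blast
    then show ?thesis
      using x(1) in_S \<U>(2) by blast
  qed
  show "\<exists>W. openin (subtopology (lower_topology X) S) W \<and> W \<noteq> {} \<and>
      {x \<in> topspace X. X closure_of {x} \<in> W} \<subseteq> V"
    if V: "openin X V" "V \<noteq> {}" for V
  \<comment> \<open>The witness is the set of members of \<open>S\<close> that meet
    \<open>V\<close>; a point whose closure meets \<open>V\<close> lies in \<open>V\<close>.\<close>
  proof (intro exI conjI)
    show "openin (subtopology (lower_topology X) S) (hit_sets X {V} \<inter> S)"
      using V(1) by (intro openin_subtopology_Int openin_hit_sets) auto
    obtain x where x: "x \<in> V" "x \<in> topspace X"
      using V openin_subset by blast
    then have "X closure_of {x} \<in> hit_sets X {V}"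
      using V(1) by (subst closure_of_singleton_in_hit_sets) auto
    then show "hit_sets X {V} \<inter> S \<noteq> {}"
      using in_S[OF x(2)] by blast
    show "{x \<in> topspace X. X closure_of {x} \<in> hit_sets X {V} \<inter> S} \<subseteq> V"
      using V(1) closure_of_singleton_in_hit_sets[of _ X "{V}"] by auto
  qed
qed

theorem proposition3p3:
  fixes X :: "'a topology"
  assumes "Baire_space X"
  shows "Baire_space (subtopology (lower_topology X) (closed_limit_sets X)) \<and>
         Baire_space (subtopology (lower_topology X) (nonempty_closed_limit_sets X))"
  using assms by (intro conjI Baire_space_limit_sets) (auto simp: nonempty_closed_limit_sets_def)

end
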